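(* Let $n,p\in\mathbb N$, let $\lambda\ge\mu\ge 0$, $l\ge 0$ be real and let $0\le\sigma<p$. If $\delta\ge 0$ and $-1\le A_2\le A_1<B_1\le B_2\le 1$, then $$\mathcal P_{\lambda,\mu,l}^{\delta+1}(B_1,A_1;\sigma,p)\subseteq \mathcal P_{\lambda,\mu,l}^{\delta}(B_2,A_2;\sigma,p).$$
   Context: $\mathbb N=\{1,2,3,\dots\}$ and $\mathcal U=\{z\in\mathbb C:|z|<1\}$. $\mathcal A(n,p)$ is the class of functions $f(z)=z^p+\sum_{k=n+p}^\infty a_kz^k$ that are analytic and $p$-valent in $\mathcal U$ ($p$-valent: no value is taken more than $p$ times in $\mathcal U$, counted with multiplicity, and some value is taken exactly $p$ times). For real $\delta\ge0$ and $k\ge n+p$ put $$\Phi_p^k(\delta,\lambda,\mu,l)=\left[\frac{(k-p)(\lambda\mu k+\lambda-\mu)+p+l}{p+l}\right]^{\delta},\qquad \mathcal J_p^\delta(\lambda,\mu,l)f(z)=z^p+\sum_{k=n+p}^\infty\Phi_p^k(\delta,\lambda,\mu,l)\,a_kz^k .$$ For $F,G$ analytic in $\mathcal U$, $F\prec G$ (subordination) means $F(z)=G(w(z))$ in $\mathcal U$ for some analytic $w:\mathcal U\to\mathbb C$ with $w(0)=0$, $|w(z)|<1$. For $C,D\in[-1,1]$ and real $\delta\ge 0$, $\mathcal P_{\lambda,\mu,l}^{\delta}(C,D;\sigma,p)$ is the class of all $f\in\mathcal A(n,p)$ with $$\frac1{p-\sigma}\left(\frac{[\mathcal J_p^\delta(\lambda,\mu,l)f(z)]'}{z^{p-1}}-\sigma\right)\prec\frac{1+Cz}{1+Dz}\quad(z\in\mathcal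 U)$$ (the quotient by $z^{p-1}$ being extended analytically to $z=0$). *)

theory Defs
  imports "HOL-Complex_Analysis.Complex_Analysis"
begin

text \<open>Analytic functions on the open unit disc are represented by total functions
  \<^typ>\<open>complex \<Rightarrow> complex\<close> that are holomorphic there; values outside the disc are irrelevant.\<close>

abbreviation unit_disc :: "complex set"
  where "unit_disc \<equiv> ball 0 1"

definition taylor_coeff :: "(complex \<Rightarrow> complex) \<Rightarrow> nat \<Rightarrow> complex"
  where "taylor_coeff f k = fps_nth (fps_expansion f 0) k"

text \<open>The finiteness clause is needed because a sum over an infinite set is 0 by convention;
  it also excludes constant functions, for which \<^const>\<open>zorder\<close> is meaningless.\<close>

definition p_valent :: "nat \<Rightarrow> (complex \<Rightarrow> complex) \<Rightarrow> bool"
  where "p_valent p f \<longleftrightarrow>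
    (\<forall>c. finite {z \<in> unit_disc. f z = c} \<and>
         (\<Sum>z \<in> {z \<in> unit_disc. f z = c}. zorder (\<lambda>u. f u - c) z) \<le> int p) \<and>
    (\<exists>c. (\<Sum>z \<in> {z \<in> unit_disc. f z = c}. zorder (\<lambda>u. f u - c) z) = int p)"

text \<open>Coefficients of a convergent power series on the disc are unique, so the \<open>a\<^sub>k\<close> in
  \<open>f z = z^p + (\<Sum>k\<ge>n+p. a\<^sub>k z^k)\<close> are the Taylor coefficients of \<open>f\<close>. Series over
  \<open>k \<ge> n + p\<close> are indexed by \<open>k = n + p + j\<close>.\<close>

definition class_A :: "nat \<Rightarrow> nat \<Rightarrow> (complex \<Rightarrow> complex) set"
  where "class_A n p = {f. f holomorphic_on unit_disc \<and>
    (\<forall>z \<in> unit_disc. (\<lambda>j. taylor_coeff f (n + p + j) * z ^ (n + p + j)) sums (f z - z ^ p)) \<and>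
    p_valent p f}"

definition Phi :: "nat \<Rightarrow> nat \<Rightarrow> real \<Rightarrow> real \<Rightarrow> real \<Rightarrow> real \<Rightarrow> real"
  where "Phi p k \<delta> lam \<mu> l =
    (((real k - real p) * (lam * \<mu> * real k + lam - \<mu>) + real p + l) / (real p + l)) powr \<delta>"

definition J_op ::
  "nat \<Rightarrow> nat \<Rightarrow> real \<Rightarrow> real \<Rightarrow> real \<Rightarrow> real \<Rightarrow> (complex \<Rightarrow> complex) \<Rightarrow> complex \<Rightarrow> complex"
  where "J_op n p \<delta> lam \<mu> l f z = z ^ p +
    (\<Sum>j. of_real (Phi p (n + p + j) \<delta> lam \<mu> l) * taylor_coeff f (n + p + j) * z ^ (n + p + j))"

definition subordinate :: "(complex \<Rightarrow> complex) \<Rightarrow> (complex \<Rightarrow> complex) \<Rightarrow> bool"  (infix "\<prec>\<^sub>s" 50)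
  where "F \<prec>\<^sub>s G \<longleftrightarrow> (\<exists>w. w holomorphic_on unit_disc \<and> w 0 = 0 \<and>
    (\<forall>z \<in> unit_disc. norm (w z) < 1) \<and> (\<forall>z \<in> unit_disc. F z = G (w z)))"

text \<open>\<^const>\<open>remove_sings\<close> performs the analytic extension of the quotient to \<open>0\<close>.\<close>

definition class_P :: "nat \<Rightarrow> nat \<Rightarrow> real \<Rightarrow> real \<Rightarrow> real \<Rightarrow> real \<Rightarrow> real \<Rightarrow> real \<Rightarrow> real
    \<Rightarrow> (complex \<Rightarrow> complex) set"
  where "class_P n p lam \<mu> l \<delta> C D \<sigma> = {f \<in> class_A n p.
    (\<lambda>z. 1 / of_real (real p - \<sigma>) *
       (remove_sings (\<lambda>u. deriv (J_op n p \<delta> lam \<mu> l f) u / u ^ (p - 1)) z - of_real \<sigma>))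
    \<prec>\<^sub>s (\<lambda>z. (1 + of_real C * z) / (1 + of_real D * z))}"

end

theory Submission
  imports Defs "HOL-Real_Asymp.Real_Asymp"
begin

text \<open>
  Write \<open>G\<^sub>\<delta>(z)\<close> for the analytic extension of \<open>(J\<^sup>\<delta> f)'(z) / z\<^sup>p\<^sup>-\<^sup>1\<close> and
  \<open>F\<^sub>\<delta> = (G\<^sub>\<delta> - \<sigma>) / (p - \<sigma>)\<close>. Passing from \<open>\<delta>\<close> to \<open>\<delta> + 1\<close> multiplies the coefficient of
  \<open>z\<^sup>m\<close> by the quadratic polynomial \<open>1 + a m + b m\<^sup>2\<close> with
  \<open>a = (\<lambda>\<mu>p + \<lambda> - \<mu>) / (p + l) \<ge> 0\<close> and \<open>b = \<lambda>\<mu> / (p + l) \<ge> 0\<close>. In terms of the Euler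
  operator \<open>E = z d/dz\<close> this is the differential identity
  \<open>F\<^sub>\<delta>\<^sub>+\<^sub>1 = F\<^sub>\<delta> + a EF\<^sub>\<delta> + b E\<^sup>2F\<^sub>\<delta>\<close> (lemma \<open>J_quotient_add_one\<close>).

  The core of the proof is that undoing such an operator keeps the range inside convex sets
  (lemma \<open>convex_range_euler\<close>): if \<open>P + a EP + b E\<^sup>2P\<close> maps the disc into an open convex set,
  then so does \<open>P\<close>. An open convex set is an intersection of open half-planes, so it is enough to
  bound a real linear functional \<open>u\<close> of \<open>P\<close>. Take a maximum point of \<open>u\<close> on a closed disc. There
  the outward radial derivative, which is the functional applied to \<open>EP\<close>, is nonnegative, and the
  second derivative along the circle, which is minus the functional applied to \<open>E\<^sup>2P\<close>, is
  nonpositive. Hence at that point \<open>u\<close> is at most the functional of \<open>P + a EP + b E\<^sup>2P\<close>.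

  Finally, the map \<open>w \<mapsto> (1 + C w) / (1 + D w)\<close> sends the disc bijectively onto
  \<open>{\<zeta>. \<bar>\<zeta> - 1\<bar> < \<bar>C - D \<zeta>\<bar>}\<close>, a disc or a half-plane. Subordination to it amounts to the value
  \<open>1\<close> at \<open>0\<close> together with inclusion of the range in this convex set
  (lemma \<open>subordinate_moebiusI\<close>), and the set for \<open>(B\<^sub>1, A\<^sub>1)\<close> lies in the one for
  \<open>(B\<^sub>2, A\<^sub>2)\<close> (lemma \<open>moebius_in_janowski_domain\<close>).
\<close>

section \<open>A convexity principle for the Euler operator\<close>

definition euler :: "(complex \<Rightarrow> complex) \<Rightarrow> complex \<Rightarrow> complex"
  where "euler f z = z * deriv f z"

lemma euler_cong:
  assumes "\<And>z. z \<in> unit_disc \<Longrightarrow> f z = g z" "z \<in> unit_disc"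
  shows "euler f z = euler g z"
proof -
  have "eventually (\<lambda>u. f u = g u) (nhds z)"
    using assms unfolding eventually_nhds by (intro exI[of _ unit_disc]) auto
  then have "deriv f z = deriv g z"
    by (intro deriv_cong_ev refl)
  then show ?thesis
    by (simp add: euler_def)
qed

lemma holomorphic_on_euler [holomorphic_intros]:
  "f holomorphic_on unit_disc \<Longrightarrow> euler f holomorphic_on unit_disc"
  unfolding euler_def by (intro holomorphic_intros) auto

text \<open>If \<open>d\<close> were positive, \<open>f'\<close> would be positive just to the right of its zero \<open>x\<close>, and \<open>f\<close> would
  exceed its maximum there.\<close>

lemma second_derivative_nonpos_at_max:
  fixes f f' :: "real \<Rightarrow> real"
  assumes f: "\<And>t. (f has_real_derivative f' t) (at t)"
    and f': "(f' has_real_derivative d) (at x)"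
    and max: "\<And>t. f t \<le> f x"
  shows "d \<le> 0"
proof (rule ccontr)
  assume "\<not> d \<le> 0"
  then have "d > 0" by simp
  then obtain e where e: "e > 0" "\<And>h. h > 0 \<Longrightarrow> h < e \<Longrightarrow> f' x < f' (x + h)"
    using DERIV_pos_inc_right[OF f'] by blast
  have "f' x = 0"
    using DERIV_local_max[OF f zero_less_one] max by blast
  then have pos: "f' t > 0" if "x < t" "t < x + e" for t
    using e(2)[of "t - x"] that by auto
  have "f x < f (x + e)"
  proof (rule DERIV_pos_imp_increasing_open[where f = f])
    show "continuous_on {x..x + e} f"
      using f by (meson DERIV_isCont continuous_at_imp_continuous_on)
  qed (use \<open>e > 0\<close> f pos in auto)
  then show False
    using max[of "x + e"] by simp
qed

lemma nonneg_derivative_at_left_max: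
  fixes f :: "real \<Rightarrow> real"
  assumes f: "(f has_real_derivative d) (at x)" and max: "\<And>t. t \<le> x \<Longrightarrow> f t \<le> f x"
  shows "d \<ge> 0"
proof (rule ccontr)
  assume "\<not> d \<ge> 0"
  then obtain e where e: "e > 0" "\<And>h. h > 0 \<Longrightarrow> h < e \<Longrightarrow> f x < f (x - h)"
    using DERIV_neg_dec_left[OF f] by (auto simp: not_le)
  show False
    using e(2)[of "e / 2"] max[of "x - e / 2"] e(1) by simp
qed

text \<open>Along a curve \<open>t \<mapsto> z\<^sub>0 exp(c t)\<close>, differentiation in \<open>t\<close> is \<open>c\<close> times the Euler operator. The
  choice \<open>c = 1\<close> gives rays and \<open>c = \<i>\<close> gives circles around the origin.\<close>

lemma has_real_derivative_inner_along_exp: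
  fixes \<kappa> c z\<^sub>0 :: complex
  assumes f: "f holomorphic_on unit_disc" and z: "z\<^sub>0 * exp (c * of_real t) \<in> unit_disc"
  shows "((\<lambda>t. inner \<kappa> (f (z\<^sub>0 * exp (c * of_real t)))) has_real_derivative
           inner \<kappa> (c * euler f (z\<^sub>0 * exp (c * of_real t)))) (at t)"
proof -
  define g where "g = (\<lambda>u. z\<^sub>0 * exp (c * u))"
  have g: "(g has_field_derivative c * g u) (at u)" for u
    unfolding g_def by (auto intro!: derivative_eq_intros)
  have "(f has_field_derivative deriv f (g (of_real t))) (at (g (of_real t)))"
    using holomorphic_derivI[OF f] z by (simp add: g_def)
  from DERIV_chain2[OF this g]
  have "((\<lambda>u. f (g u)) has_field_derivative c * euler f (g (of_real t))) (at (of_real t))"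
    by (simp add: euler_def ac_simps)
  then have "((\<lambda>t. f (g (of_real t))) has_vector_derivative c * euler f (g (of_real t))) (at t)"
    by (rule has_vector_derivative_real_field)
  then have "((\<lambda>t. inner \<kappa> (f (g (of_real t)))) has_vector_derivative
      inner \<kappa> (c * euler f (g (of_real t)))) (at t)"
    by (rule bounded_linear.has_vector_derivative[OF bounded_linear_inner_right])
  then show ?thesis
    by (simp add: g_def has_real_derivative_iff_has_vector_derivative)
qed

text \<open>The maximum-point argument for one half-plane. The inner product with \<open>\<kappa>\<close> is the general real
  linear functional on the plane.\<close>

lemma halfplane_euler:
  fixes P :: "complex \<Rightarrow> complex"
  assumes P: "P holomorphic_on unit_disc" and a: "a \<ge> 0" and b: "b \<ge> 0"
    and Q: "\<And>z. z \<in> unit_disc \<Longrightarrow>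
      inner \<kappa> (P z + of_real a * euler P z + of_real b * euler (euler P) z) < s"
    and z: "z \<in> unit_disc"
  shows "inner \<kappa> (P z) < s"
proof -
  have sub: "cball 0 (norm z) \<subseteq> unit_disc" using z by auto
  have "continuous_on (cball 0 (norm z)) (\<lambda>u. inner \<kappa> (P u))"
    by (intro continuous_intros holomorphic_on_imp_continuous_on holomorphic_on_subset[OF P sub])
  then obtain z\<^sub>0 where z\<^sub>0: "z\<^sub>0 \<in> cball 0 (norm z)"
    and max: "\<And>u. u \<in> cball 0 (norm z) \<Longrightarrow> inner \<kappa> (P u) \<le> inner \<kappa> (P z\<^sub>0)"
    using continuous_attains_sup[of "cball 0 (norm z)" "\<lambda>u. inner \<kappa> (P u)"]
    by (metis ball_eq_empty cball_eq_empty compact_cball norm_not_less_zero)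
  have z\<^sub>0_disc: "z\<^sub>0 \<in> unit_disc" using z\<^sub>0 sub by blast
  \<comment> \<open>The maximum is taken over the whole closed disc, so both the inward ray and the circle
    through \<open>z\<^sub>0\<close> stay among the competitors, even if \<open>z\<^sub>0\<close> is an interior point.\<close>
  have ray: "z\<^sub>0 * exp (1 * of_real t) \<in> cball 0 (norm z)" if "t \<le> 0" for t :: real
  proof -
    have "norm z\<^sub>0 * exp t \<le> norm z * 1"
      using z\<^sub>0 that by (intro mult_mono) auto
    then show ?thesis by (simp add: norm_mult)
  qed
  have circle: "z\<^sub>0 * exp (\<i> * of_real t) \<in> cball 0 (norm z)" for t :: real
    using z\<^sub>0 by (simp add: norm_mult)
  have E1: "inner \<kappa> (euler P z\<^sub>0) \<ge> 0"
  proof (rule nonneg_derivative_at_left_max)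
    show "((\<lambda>t. inner \<kappa> (P (z\<^sub>0 * exp (1 * of_real t)))) has_real_derivative
        inner \<kappa> (euler P z\<^sub>0)) (at 0)"
      using has_real_derivative_inner_along_exp[of P z\<^sub>0 1 0 \<kappa>] P z\<^sub>0_disc by simp
    show "inner \<kappa> (P (z\<^sub>0 * exp (1 * of_real t))) \<le> inner \<kappa> (P (z\<^sub>0 * exp (1 * of_real 0)))"
      if "t \<le> 0" for t
      using max[OF ray[OF that]] by simp
  qed
  have \<i>_inner: "inner \<kappa> (\<i> * w) = inner (- \<i> * \<kappa>) w" for w
    by (simp add: inner_complex_def)
  \<comment> \<open>Differentiating twice along the circle produces the factor \<open>\<i>\<^sup>2 = -1\<close>. The first \<open>\<i>\<close> is moved
    to the functional so that the derivative is again a functional of \<open>euler P\<close>.\<close>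
  have "inner (- \<i> * \<kappa>) (\<i> * euler (euler P) z\<^sub>0) \<le> 0"
  proof (rule second_derivative_nonpos_at_max)
    show "((\<lambda>t. inner \<kappa> (P (z\<^sub>0 * exp (\<i> * of_real t)))) has_real_derivative
        inner (- \<i> * \<kappa>) (euler P (z\<^sub>0 * exp (\<i> * of_real t)))) (at t)" for t
      unfolding \<i>_inner[symmetric]
      by (rule has_real_derivative_inner_along_exp[OF P subsetD[OF sub circle]])
    show "((\<lambda>t. inner (- \<i> * \<kappa>) (euler P (z\<^sub>0 * exp (\<i> * of_real t)))) has_real_derivative
        inner (- \<i> * \<kappa>) (\<i> * euler (euler P) z\<^sub>0)) (at 0)"
      using has_real_derivative_inner_along_exp[of "euler P" z\<^sub>0 \<i> 0 "- \<i> * \<kappa>"]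
        holomorphic_on_euler[OF P] z\<^sub>0_disc by simp
    show "inner \<kappa> (P (z\<^sub>0 * exp (\<i> * of_real t))) \<le> inner \<kappa> (P (z\<^sub>0 * exp (\<i> * of_real 0)))" for t
      using max[OF circle[of t]] by simp
  qed
  then have E2: "inner \<kappa> (euler (euler P) z\<^sub>0) \<ge> 0"
    by (simp add: inner_complex_def)
  have "inner \<kappa> (P z) \<le> inner \<kappa> (P z\<^sub>0)"
    using max by simp
  also have "\<dots> \<le> inner \<kappa> (P z\<^sub>0) + a * inner \<kappa> (euler P z\<^sub>0) + b * inner \<kappa> (euler (euler P) z\<^sub>0)"
    using a b E1 E2 by simp
  also have "\<dots> = inner \<kappa> (P z\<^sub>0 + of_real a * euler P z\<^sub>0 + of_real b * euler (euler P) z\<^sub>0)"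
    unfolding scaleR_conv_of_real[symmetric] inner_add_right inner_scaleR_right ..
  also have "\<dots> < s"
    by (rule Q[OF z\<^sub>0_disc])
  finally show ?thesis .
qed

text \<open>Openness is what makes the separation strict on the side of \<open>K\<close>.\<close>

lemma open_convex_separate_point:
  fixes K :: "'a::euclidean_space set"
  assumes "convex K" "open K" "\<zeta> \<notin> K"
  obtains \<kappa> where "\<And>x. x \<in> K \<Longrightarrow> inner \<kappa> x < inner \<kappa> \<zeta>"
proof (cases "K = {}")
  case False
  obtain \<kappa> b where "\<kappa> \<noteq> 0" and K: "\<And>x. x \<in> K \<Longrightarrow> inner \<kappa> x \<le> b" and "b \<le> inner \<kappa> \<zeta>"
    using separating_hyperplane_sets[of K "{\<zeta>}"] assms False by auto
  have "K \<subseteq> interior {x. inner \<kappa> x \<le> b}"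
    using K \<open>open K\<close> by (intro interior_maximal) auto
  then have "inner \<kappa> x < b" if "x \<in> K" for x
    using that \<open>\<kappa> \<noteq> 0\<close> by (auto simp: interior_halfspace_le)
  with \<open>b \<le> inner \<kappa> \<zeta>\<close> show ?thesis
    using that[of \<kappa>] by fastforce
qed (use that in blast)

lemma convex_range_euler:
  fixes P :: "complex \<Rightarrow> complex"
  assumes "P holomorphic_on unit_disc" "a \<ge> 0" "b \<ge> 0" and K: "convex K" "open K"
    and Q: "\<And>z. z \<in> unit_disc \<Longrightarrow>
      P z + of_real a * euler P z + of_real b * euler (euler P) z \<in> K"
    and z: "z \<in> unit_disc"
  shows "P z \<in> K"
proof (rule ccontr)
  assume "P z \<notin> K"
  then obtain \<kappa> where "\<And>x. x \<in> K \<Longrightarrow> inner \<kappa> x < inner \<kappa> (P z)"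
    using open_convex_separate_point[OF K] by blast
  then have "inner \<kappa> (P z) < inner \<kappa> (P z)"
    using assms by (intro halfplane_euler[of P a b]) auto
  then show False by simp
qed

section \<open>The range of the Moebius map and subordination\<close>

text \<open>The image of the unit disc under \<open>w \<mapsto> (1 + C w) / (1 + D w)\<close>: solving for \<open>w\<close> gives
  \<open>w = (\<zeta> - 1) / (C - D \<zeta>)\<close>. This form treats the half-plane case \<open>\<bar>D\<bar> = 1\<close> and the disc case
  \<open>\<bar>D\<bar> < 1\<close> at once.\<close>

definition janowski_domain :: "real \<Rightarrow> real \<Rightarrow> complex set"
  where "janowski_domain C D = {\<zeta>. norm (\<zeta> - 1) < norm (of_real C - of_real D * \<zeta>)}"

lemma open_janowski_domain: "open (janowski_domain C D)"
  unfolding janowski_domain_def by (intro open_Collect_less continuous_intros)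

text \<open>The domain is the sublevel set of \<open>q \<zeta> = \<bar>\<zeta> - 1\<bar>\<^sup>2 - \<bar>C - D \<zeta>\<bar>\<^sup>2\<close>, a quadratic function
  whose second-order part \<open>(1 - D\<^sup>2) \<bar>\<zeta>\<bar>\<^sup>2\<close> is nonnegative.\<close>

lemma convex_janowski_domain:
  assumes "\<bar>D\<bar> \<le> 1"
  shows "convex (janowski_domain C D)"
proof -
  define q where "q \<zeta> = (norm (\<zeta> - 1))\<^sup>2 - (norm (of_real C - of_real D * \<zeta>))\<^sup>2" for \<zeta> :: complex
  have mem: "\<zeta> \<in> janowski_domain C D \<longleftrightarrow> q \<zeta> < 0" for \<zeta>
    by (auto simp: janowski_domain_def q_def power_strict_mono dest: power_less_imp_less_base)
  have q_convex: "q (u *\<^sub>R x + v *\<^sub>R y) = u * q x + v * q y - u * v * (1 - D\<^sup>2) * (norm (x - y))\<^sup>2"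
    if "u + v = 1" for u v x y
  proof -
    have v: "v = 1 - u" using that by simp
    show ?thesis
      unfolding q_def v cmod_power2 by (simp add: power2_eq_square algebra_simps)
  qed
  have "D\<^sup>2 \<le> 1" using assms by (simp add: abs_square_le_1)
  show ?thesis
  proof (rule convexI)
    fix x y and u v :: real
    assume xy: "x \<in> janowski_domain C D" "y \<in> janowski_domain C D" and uv: "0 \<le> u" "0 \<le> v" "u + v = 1"
    have "0 \<le> u * v * (1 - D\<^sup>2) * (norm (x - y))\<^sup>2"
      using uv \<open>D\<^sup>2 \<le> 1\<close> by simp
    moreover have "u * q x + v * q y < 0"
      using xy uv by (intro convex_bound_lt) (auto simp: mem)
    ultimately show "u *\<^sub>R x + v *\<^sub>R y \<in> janowski_domain C D"
      using q_convex[OF \<open>u + v = 1\<close>] by (simp add: mem)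
  qed
qed

lemma one_plus_real_mult_nonzero:
  fixes w :: complex
  assumes "norm w < 1" "\<bar>D\<bar> \<le> 1"
  shows "1 + of_real D * w \<noteq> 0"
proof
  assume "1 + of_real D * w = 0"
  then have "norm (of_real D * w) = 1"
    by (metis add_eq_0_iff norm_minus_cancel norm_one)
  moreover have "\<bar>D\<bar> * norm w \<le> norm w" using assms(2) by (simp add: mult_left_le_one_le)
  ultimately show False
    using assms(1) by (simp add: norm_mult)
qed

text \<open>The inverse of the second Moebius map composed with the first one is
  \<open>w \<mapsto> (B\<^sub>1 - A\<^sub>1) w / ((B\<^sub>2 - A\<^sub>2) + d w)\<close> with \<open>d = B\<^sub>2 A\<^sub>1 - A\<^sub>2 B\<^sub>1\<close>; it maps the disc into itself
  because \<open>B\<^sub>1 - A\<^sub>1 + \<bar>d\<bar> \<le> B\<^sub>2 - A\<^sub>2\<close>. The latter follows from nesting and from all parameters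
  lying in \<open>[-1, 1]\<close>.\<close>

lemma moebius_in_janowski_domain:
  fixes w :: complex
  assumes "norm w < 1" "- 1 \<le> A\<^sub>2" "A\<^sub>2 \<le> A\<^sub>1" "A\<^sub>1 < B\<^sub>1" "B\<^sub>1 \<le> B\<^sub>2" "B\<^sub>2 \<le> 1"
  shows "(1 + of_real B\<^sub>1 * w) / (1 + of_real A\<^sub>1 * w) \<in> janowski_domain B\<^sub>2 A\<^sub>2"
proof -
  define \<zeta> where "\<zeta> = (1 + of_real B\<^sub>1 * w) / (1 + of_real A\<^sub>1 * w)"
  define d where "d = B\<^sub>2 * A\<^sub>1 - A\<^sub>2 * B\<^sub>1"
  have nz: "1 + of_real A\<^sub>1 * w \<noteq> 0"
    using assms by (intro one_plus_real_mult_nonzero) auto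
  have num: "\<zeta> - 1 = of_real (B\<^sub>1 - A\<^sub>1) * w / (1 + of_real A\<^sub>1 * w)"
    using nz by (simp add: \<zeta>_def field_simps)
  have den: "of_real B\<^sub>2 - of_real A\<^sub>2 * \<zeta> = (of_real (B\<^sub>2 - A\<^sub>2) + of_real d * w) / (1 + of_real A\<^sub>1 * w)"
    using nz by (simp add: \<zeta>_def d_def field_simps)
  have d: "B\<^sub>1 - A\<^sub>1 + \<bar>d\<bar> \<le> B\<^sub>2 - A\<^sub>2"
  proof -
    have "(B\<^sub>2 - B\<^sub>1) * (1 - A\<^sub>1) \<ge> 0" "(A\<^sub>1 - A\<^sub>2) * (1 - B\<^sub>1) \<ge> 0"
      "(B\<^sub>2 - B\<^sub>1) * (1 + A\<^sub>1) \<ge> 0" "(A\<^sub>1 - A\<^sub>2) * (1 + B\<^sub>1) \<ge> 0"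
      using assms by (auto intro!: mult_nonneg_nonneg)
    then show ?thesis
      unfolding d_def by (simp add: algebra_simps abs_if)
  qed
  have "norm (of_real (B\<^sub>1 - A\<^sub>1) * w) = (B\<^sub>1 - A\<^sub>1) * norm w"
    using assms by (simp add: norm_mult del: of_real_diff)
  also have "\<dots> < B\<^sub>1 - A\<^sub>1" using assms by simp
  also have "\<dots> \<le> (B\<^sub>2 - A\<^sub>2) - \<bar>d\<bar> * norm w"
  proof -
    have "\<bar>d\<bar> * norm w \<le> \<bar>d\<bar>" using assms(1) by (simp add: mult_left_le)
    then show ?thesis using d by simp
  qed
  also have "\<dots> \<le> norm (of_real (B\<^sub>2 - A\<^sub>2) + of_real d * w)"
  proof -
    have "norm (of_real (B\<^sub>2 - A\<^sub>2) :: complex) = B\<^sub>2 - A\<^sub>2"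
      using assms by (simp del: of_real_diff)
    then show ?thesis
      using norm_diff_ineq[of "of_real (B\<^sub>2 - A\<^sub>2) :: complex" "of_real d * w"]
      by (simp add: norm_mult del: of_real_diff)
  qed
  finally have "norm (\<zeta> - 1) < norm (of_real B\<^sub>2 - of_real A\<^sub>2 * \<zeta>)"
    using nz unfolding num den by (simp add: norm_divide divide_strict_right_mono)
  then show ?thesis
    by (simp add: janowski_domain_def \<zeta>_def)
qed

text \<open>The Moebius map is univalent, so the subordinating function is its inverse applied to \<open>F\<close>.\<close>

lemma subordinate_moebiusI:
  assumes F: "F holomorphic_on unit_disc" "F 0 = 1"
    and CD: "\<bar>D\<bar> \<le> 1" "D < C"
    and range: "\<And>z. z \<in> unit_disc \<Longrightarrow> F z \<in> janowski_domain C D"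
  shows "F \<prec>\<^sub>s (\<lambda>z. (1 + of_real C * z) / (1 + of_real D * z))"
proof -
  define w where "w z = (F z - 1) / (of_real C - of_real D * F z)" for z
  have lt: "norm (F z - 1) < norm (of_real C - of_real D * F z)" if "z \<in> unit_disc" for z
    using range[OF that] by (simp add: janowski_domain_def)
  have nz: "of_real C - of_real D * F z \<noteq> 0" if "z \<in> unit_disc" for z
    using lt[OF that] by auto
  have w_lt: "norm (w z) < 1" if "z \<in> unit_disc" for z
    using lt[OF that] nz[OF that] by (simp add: w_def norm_divide)
  have "w holomorphic_on unit_disc"
    unfolding w_def by (intro holomorphic_intros F nz)
  moreover have "w 0 = 0" by (simp add: w_def F)
  moreover have "F z = (1 + of_real C * w z) / (1 + of_real D * w z)" if "z \<in> unit_disc" for z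
  proof -
    have "1 + of_real C * w z = of_real (C - D) * F z / (of_real C - of_real D * F z)"
      "1 + of_real D * w z = of_real (C - D) / (of_real C - of_real D * F z)"
      using nz[OF that] by (simp_all add: w_def field_simps)
    then show ?thesis
      using nz[OF that] CD by (simp del: of_real_diff)
  qed
  ultimately show ?thesis
    unfolding subordinate_def using w_lt by blast
qed

lemma subordinate_cong:
  assumes "\<And>z. z \<in> unit_disc \<Longrightarrow> F z = F' z"
  shows "F \<prec>\<^sub>s G \<longleftrightarrow> F' \<prec>\<^sub>s G"
  using assms by (simp add: subordinate_def)

section \<open>Power series on the unit disc\<close>

definition disc_summable :: "(nat \<Rightarrow> complex) \<Rightarrow> bool"
  where "disc_summable c \<longleftrightarrow> (\<forall>z \<in> unit_disc. summable (\<lambda>k. c k * z ^ k))"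

definition powser :: "(nat \<Rightarrow> complex) \<Rightarrow> complex \<Rightarrow> complex"
  where "powser c z = (\<Sum>k. c k * z ^ k)"

lemma powser_sums:
  "disc_summable c \<Longrightarrow> z \<in> unit_disc \<Longrightarrow> (\<lambda>k. c k * z ^ k) sums powser c z"
  by (simp add: disc_summable_def powser_def summable_sums)

lemma
  assumes c: "disc_summable c" and z: "z \<in> unit_disc"
  shows powser_has_derivative: "(powser c has_field_derivative (\<Sum>k. diffs c k * z ^ k)) (at z)"
    and euler_powser_sums: "(\<lambda>k. of_nat k * c k * z ^ k) sums euler (powser c) z"
proof -
  have sm: "summable (\<lambda>k. c k * u ^ k)" if "norm u < 1" for u
    using c that by (simp add: disc_summable_def)
  have "norm z < 1" using z by simp
  show *: "(powser c has_field_derivative (\<Sum>k. diffs c k * z ^ k)) (at z)"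
    unfolding powser_def by (rule termdiffs_strong'[OF sm \<open>norm z < 1\<close>])
  have "(\<lambda>k. of_nat k * c k * z ^ (k - Suc 0)) sums deriv (powser c) z"
    unfolding DERIV_imp_deriv[OF *]
    by (rule diffs_equiv[OF termdiff_converges[OF \<open>norm z < 1\<close> sm]])
  then have "(\<lambda>k. z * (of_nat k * c k * z ^ (k - Suc 0))) sums euler (powser c) z"
    unfolding euler_def by (rule sums_mult)
  moreover have "z * (of_nat k * c k * z ^ (k - Suc 0)) = of_nat k * c k * z ^ k" for k
    by (cases k) auto
  ultimately show "(\<lambda>k. of_nat k * c k * z ^ k) sums euler (powser c) z"
    by simp
qed

lemma holomorphic_on_powser: "disc_summable c \<Longrightarrow> powser c holomorphic_on unit_disc"
  by (auto simp: holomorphic_on_open intro!: exI powser_has_derivative)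

lemma disc_summable_of_nat_mult:
  "disc_summable c \<Longrightarrow> disc_summable (\<lambda>k. of_nat k * c k)"
  unfolding disc_summable_def[of "\<lambda>k. of_nat k * c k"]
  using euler_powser_sums by (auto simp: sums_iff)

lemma euler_powser:
  "disc_summable c \<Longrightarrow> z \<in> unit_disc \<Longrightarrow> euler (powser c) z = powser (\<lambda>k. of_nat k * c k) z"
  using euler_powser_sums by (simp add: powser_def sums_iff)

text \<open>Multipliers of subexponential growth do not shrink the disc of convergence: split \<open>\<bar>z\<bar> = s r\<close> with
  \<open>r, s < 1\<close>, let \<open>s\<^sup>k\<close> absorb the multiplier and \<open>r\<^sup>k\<close> give absolute convergence.\<close>

lemma disc_summable_multiplier:
  fixes c :: "nat \<Rightarrow> complex" and u :: "nat \<Rightarrow> real"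
  assumes c: "disc_summable c"
    and u: "\<And>s. 0 < s \<Longrightarrow> s < 1 \<Longrightarrow> (\<lambda>k. u k * s ^ k) \<longlonglongrightarrow> 0"
  shows "disc_summable (\<lambda>k. of_real (u k) * c k)"
  unfolding disc_summable_def
proof
  fix z :: complex assume z: "z \<in> unit_disc"
  \<comment> \<open>Any \<open>s\<close> strictly between \<open>\<bar>z\<bar>\<close> and \<open>1\<close> would do; it is positive also for \<open>z = 0\<close>.\<close>
  define s where "s = (1 + norm z) / 2"
  define r where "r = norm z / s"
  have s: "0 < s" "s < 1" "norm z < s" using z by (auto simp: s_def field_simps add_pos_nonneg)
  have r: "0 \<le> r" "r < 1" using s by (auto simp: r_def)
  have "summable (\<lambda>k. norm (c k * of_real r ^ k))"
  proof (rule powser_insidea)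
    show "summable (\<lambda>k. c k * of_real ((1 + r) / 2) ^ k)"
      using c r unfolding disc_summable_def by (auto simp del: of_real_divide of_real_add)
    show "norm (of_real r :: complex) < norm (of_real ((1 + r) / 2) :: complex)"
      using r by (simp del: of_real_divide of_real_add)
  qed
  obtain B where B: "\<And>k. norm (u k * s ^ k) \<le> B"
    using convergent_imp_Bseq[OF convergentI[OF u[OF s(1,2)]]] unfolding Bseq_def by blast
  have "summable (\<lambda>k. norm (of_real (u k) * c k * z ^ k))"
  proof (rule summable_comparison_test'[where N = 0])
    show "summable (\<lambda>k. B * norm (c k * of_real r ^ k))"
      by (rule summable_mult) fact
    show "norm (norm (of_real (u k) * c k * z ^ k)) \<le> B * norm (c k * of_real r ^ k)" for k
    proof -
      have "norm z ^ k = s ^ k * r ^ k"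
        using s by (simp add: r_def flip: power_mult_distrib)
      then have "norm (norm (of_real (u k) * c k * z ^ k)) = norm (u k * s ^ k) * norm (c k * of_real r ^ k)"
        using s r by (simp add: norm_mult norm_power abs_mult)
      also have "\<dots> \<le> B * norm (c k * of_real r ^ k)"
        by (rule mult_right_mono[OF B norm_ge_zero])
      finally show ?thesis .
    qed
  qed
  then show "summable (\<lambda>k. of_real (u k) * c k * z ^ k)"
    by (rule summable_norm_cancel)
qed

lemma disc_summable_shift:
  "disc_summable (\<lambda>k. c (k + m)) \<longleftrightarrow> disc_summable c"
  by (simp add: disc_summable_def summable_powser_ignore_initial_segment)

lemma powser_shift:
  assumes c: "disc_summable c" and z: "z \<in> unit_disc" and zero: "\<And>k. k < m \<Longrightarrow> c k = 0"
  shows "powser c z = z ^ m * powser (\<lambda>k. c (k + m)) z"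
proof -
  have "powser c z = (\<Sum>k. c (k + m) * z ^ (k + m)) + (\<Sum>k<m. c k * z ^ k)"
    using c z unfolding powser_def by (intro suminf_split_initial_segment) (auto simp: disc_summable_def)
  also have "(\<Sum>k<m. c k * z ^ k) = 0"
    by (simp add: zero)
  also have "(\<Sum>k. c (k + m) * z ^ (k + m)) = (\<Sum>k. z ^ m * (c (k + m) * z ^ k))"
    by (simp add: power_add ac_simps)
  also have "\<dots> = z ^ m * powser (\<lambda>k. c (k + m)) z"
    unfolding powser_def using c z
    by (intro suminf_mult) (simp add: disc_summable_def summable_powser_ignore_initial_segment)
  finally show ?thesis by simp
qed

section \<open>The multiplier operator as a power series\<close>

text \<open>The coefficients of \<open>z\<^sup>p + \<Sum>\<^bsub>k \<ge> n + p\<^esub> a\<^sub>k z\<^sup>k\<close> over the whole index range, so that all series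
  below start at \<open>0\<close>.\<close>

definition normalized_coeff :: "nat \<Rightarrow> nat \<Rightarrow> (complex \<Rightarrow> complex) \<Rightarrow> nat \<Rightarrow> complex"
  where "normalized_coeff n p f k = (if k = p then 1 else if k < n + p then 0 else taylor_coeff f k)"

lemma disc_summable_normalized_coeff:
  assumes "f \<in> class_A n p"
  shows "disc_summable (normalized_coeff n p f)"
  unfolding disc_summable_def
proof
  fix z :: complex assume "z \<in> unit_disc"
  then have "summable (\<lambda>j. taylor_coeff f (n + p + j) * z ^ (n + p + j))"
    using assms by (auto simp: class_A_def sums_iff)
  then have "summable (\<lambda>j. normalized_coeff n p f (j + (n + p + 1)) * z ^ (j + (n + p + 1)))"
    by (subst (asm) summable_iff_shift[where k = 1, symmetric]) (simp add: normalized_coeff_def ac_simps)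
  then show "summable (\<lambda>k. normalized_coeff n p f k * z ^ k)"
    using summable_iff_shift[of "\<lambda>k. normalized_coeff n p f k * z ^ k" "n + p + 1"] by blast
qed

text \<open>The base of the power in \<open>\<Phi>\<close> at \<open>k = m + p\<close> is a quadratic polynomial in \<open>m\<close> with constant
  term \<open>1\<close>. Its positivity is needed for the law \<open>q powr (\<delta> + 1) = q powr \<delta> * q\<close>.\<close>

lemma Phi_add_one:
  assumes "p \<ge> 1" "lam \<ge> \<mu>" "\<mu> \<ge> 0" "l \<ge> 0"
  shows "Phi p (m + p) (\<delta> + 1) lam \<mu> l =
    (1 + (lam * \<mu> * real p + lam - \<mu>) / (real p + l) * real m
       + lam * \<mu> / (real p + l) * (real m)\<^sup>2) * Phi p (m + p) \<delta> lam \<mu> l"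
proof -
  define q where "q = (real m * (lam * \<mu> * real (m + p) + lam - \<mu>) + real p + l) / (real p + l)"
  have "real p + l > 0" using assms by simp
  moreover have "0 \<le> real m * (lam * \<mu> * real (m + p) + (lam - \<mu>))"
    using assms by (intro mult_nonneg_nonneg add_nonneg_nonneg) auto
  ultimately have "q > 0" by (simp add: q_def add_diff_eq)
  have "real m * (lam * \<mu> * real (m + p) + lam - \<mu>) + real p + l =
      (real p + l) + (lam * \<mu> * real p + lam - \<mu>) * real m + lam * \<mu> * (real m)\<^sup>2"
    by (simp add: algebra_simps power2_eq_square)
  moreover have "real p / (real p + l) + l / (real p + l) = 1"
    using \<open>real p + l > 0\<close> by (simp flip: add_divide_distrib)
  ultimately have "q = 1 + (lam * \<mu> * real p + lam - \<mu>) / (real p + l) * real m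
       + lam * \<mu> / (real p + l) * (real m)\<^sup>2"
    using \<open>real p + l > 0\<close> by (simp add: q_def add_divide_distrib)
  moreover have "Phi p (m + p) \<epsilon> lam \<mu> l = q powr \<epsilon>" for \<epsilon>
    by (simp add: Phi_def q_def)
  ultimately show ?thesis
    using \<open>q > 0\<close> by (simp add: powr_add)
qed

lemma Phi_at_p:
  assumes "p \<ge> 1" "l \<ge> 0"
  shows "Phi p p \<delta> lam \<mu> l = 1"
proof -
  have "real p + l \<noteq> 0" using assms by linarith
  then show ?thesis by (simp add: Phi_def)
qed

text \<open>For \<open>k \<ge> p\<close> the base is at most a constant times \<open>(k + 1)\<^sup>2\<close>, because \<open>p + l \<ge> 1\<close>.\<close>

lemma Phi_subexponential:
  fixes s :: real
  assumes "p \<ge> 1" "lam \<ge> \<mu>" "\<mu> \<ge> 0" "l \<ge> 0" "\<delta> \<ge> 0" and s: "0 < s" "s < 1"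
  shows "(\<lambda>k. Phi p k \<delta> lam \<mu> l * s ^ k) \<longlonglongrightarrow> 0"
proof -
  define C where "C = lam * \<mu> + lam - \<mu> + 1"
  have "lam * \<mu> \<ge> 0" using assms by (intro mult_nonneg_nonneg) auto
  then have "C > 0" using assms unfolding C_def by linarith
  have bound: "Phi p k \<delta> lam \<mu> l \<le> (C * (real k + 1)\<^sup>2) powr \<delta>" if "k \<ge> p" for k
  proof -
    define x where "x = (real k - real p) * (lam * \<mu> * real k + lam - \<mu>)"
    have x: "0 \<le> x"
      using that assms \<open>lam * \<mu> \<ge> 0\<close> by (auto simp: x_def add_diff_eq[symmetric])
    have "x \<le> (real k + 1) * ((C - 1) * (real k + 1))"
      unfolding x_def
    proof (rule mult_mono)
      show "lam * \<mu> * real k + lam - \<mu> \<le> (C - 1) * (real k + 1)"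
      proof -
        have "(C - 1) * (real k + 1) = (lam * \<mu> * real k + lam - \<mu>) + (lam * \<mu> + (lam - \<mu>) * real k)"
          by (simp add: C_def algebra_simps)
        moreover have "0 \<le> (lam - \<mu>) * real k" using assms by simp
        ultimately show ?thesis using \<open>lam * \<mu> \<ge> 0\<close> by linarith
      qed
    qed (use that assms \<open>lam * \<mu> \<ge> 0\<close> in \<open>auto simp: add_diff_eq[symmetric]\<close>)
    moreover have "1 \<le> (real k + 1)\<^sup>2" by simp
    moreover have "C * (real k + 1)\<^sup>2 = (real k + 1) * ((C - 1) * (real k + 1)) + (real k + 1)\<^sup>2"
      by (simp add: power2_eq_square algebra_simps)
    ultimately have "x + 1 \<le> C * (real k + 1)\<^sup>2"
      by linarith
    moreover have "x / (real p + l) \<le> x"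
      using x assms by (simp add: divide_le_eq mult_le_cancel_left1)
    moreover have "(x + real p + l) / (real p + l) = x / (real p + l) + 1"
      using assms by (simp add: field_simps)
    ultimately have "(x + real p + l) / (real p + l) \<le> C * (real k + 1)\<^sup>2"
      by linarith
    moreover have "0 \<le> (x + real p + l) / (real p + l)"
      using x assms by simp
    ultimately show ?thesis
      using assms by (simp add: Phi_def x_def powr_mono2)
  qed
  show ?thesis
  proof (rule tendsto_sandwich[where f = "\<lambda>_. 0" and h = "\<lambda>k. (C * (real k + 1)\<^sup>2) powr \<delta> * s ^ k"])
    show "(\<lambda>k. (C * (real k + 1)\<^sup>2) powr \<delta> * s ^ k) \<longlonglongrightarrow> 0"
      using s \<open>C > 0\<close> \<open>\<delta> \<ge> 0\<close> by real_asymp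
    show "\<forall>\<^sub>F k in sequentially. Phi p k \<delta> lam \<mu> l * s ^ k \<le> (C * (real k + 1)\<^sup>2) powr \<delta> * s ^ k"
      using eventually_ge_at_top[of p]
      by eventually_elim (use s in \<open>auto intro!: mult_right_mono bound\<close>)
    show "\<forall>\<^sub>F k in sequentially. 0 \<le> Phi p k \<delta> lam \<mu> l * s ^ k"
      using s by (simp add: Phi_def)
  qed simp
qed

definition J_coeff ::
  "nat \<Rightarrow> nat \<Rightarrow> real \<Rightarrow> real \<Rightarrow> real \<Rightarrow> real \<Rightarrow> (complex \<Rightarrow> complex) \<Rightarrow> nat \<Rightarrow> complex"
  where "J_coeff n p \<delta> lam \<mu> l f k = of_real (Phi p k \<delta> lam \<mu> l) * normalized_coeff n p f k"

text \<open>The analytic function that extends \<open>(J\<^sup>\<delta> f)'(z) / z\<^sup>p\<^sup>-\<^sup>1\<close> to \<open>z = 0\<close>, see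
  \<open>remove_sings_deriv_J_op\<close> below.\<close>

definition J_quotient ::
  "nat \<Rightarrow> nat \<Rightarrow> real \<Rightarrow> real \<Rightarrow> real \<Rightarrow> real \<Rightarrow> (complex \<Rightarrow> complex) \<Rightarrow> complex \<Rightarrow> complex"
  where "J_quotient n p \<delta> lam \<mu> l f = powser (\<lambda>m. of_nat (m + p) * J_coeff n p \<delta> lam \<mu> l f (m + p))"

lemma disc_summable_J_coeff:
  assumes "f \<in> class_A n p" "p \<ge> 1" "lam \<ge> \<mu>" "\<mu> \<ge> 0" "l \<ge> 0" "\<delta> \<ge> 0"
  shows "disc_summable (J_coeff n p \<delta> lam \<mu> l f)"
  unfolding J_coeff_def
  by (intro disc_summable_multiplier disc_summable_normalized_coeff Phi_subexponential assms)

lemma disc_summable_J_quotient: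
  assumes "f \<in> class_A n p" "p \<ge> 1" "lam \<ge> \<mu>" "\<mu> \<ge> 0" "l \<ge> 0" "\<delta> \<ge> 0"
  shows "disc_summable (\<lambda>m. of_nat (m + p) * J_coeff n p \<delta> lam \<mu> l f (m + p))"
  using disc_summable_shift[of "\<lambda>k. of_nat k * J_coeff n p \<delta> lam \<mu> l f k" p]
    disc_summable_of_nat_mult[OF disc_summable_J_coeff[OF assms]] by simp

lemma J_op_eq_powser:
  assumes "f \<in> class_A n p" "n \<ge> 1" "p \<ge> 1" "lam \<ge> \<mu>" "\<mu> \<ge> 0" "l \<ge> 0" "\<delta> \<ge> 0"
    and z: "z \<in> unit_disc"
  shows "J_op n p \<delta> lam \<mu> l f z = powser (J_coeff n p \<delta> lam \<mu> l f) z"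
proof -
  let ?c = "J_coeff n p \<delta> lam \<mu> l f"
  have "powser ?c z = (\<Sum>j. ?c (j + (n + p)) * z ^ (j + (n + p))) + (\<Sum>k<n + p. ?c k * z ^ k)"
    unfolding powser_def
    by (intro suminf_split_initial_segment)
       (use disc_summable_J_coeff[OF assms(1,3-7)] z in \<open>auto simp: disc_summable_def\<close>)
  also have "(\<Sum>k<n + p. ?c k * z ^ k) = (\<Sum>k<n + p. if k = p then z ^ p else 0)"
    using assms by (intro sum.cong) (auto simp: J_coeff_def normalized_coeff_def Phi_at_p)
  also have "\<dots> = z ^ p"
    using \<open>n \<ge> 1\<close> by simp
  also have "(\<Sum>j. ?c (j + (n + p)) * z ^ (j + (n + p))) =
      (\<Sum>j. of_real (Phi p (n + p + j) \<delta> lam \<mu> l) * taylor_coeff f (n + p + j) * z ^ (n + p + j))"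
    using \<open>n \<ge> 1\<close> by (intro suminf_cong) (simp add: J_coeff_def normalized_coeff_def ac_simps)
  finally show ?thesis
    by (simp add: J_op_def add.commute)
qed

text \<open>The power series of \<open>z (J\<^sup>\<delta> f)'(z)\<close> starts at \<open>z\<^sup>p\<close>; cancelling \<open>z\<^sup>p\<close> identifies the
  quotient on the punctured disc, and continuity of the remaining series does the rest.\<close>

lemma remove_sings_deriv_J_op:
  assumes "f \<in> class_A n p" "n \<ge> 1" "p \<ge> 1" "lam \<ge> \<mu>" "\<mu> \<ge> 0" "l \<ge> 0" "\<delta> \<ge> 0"
    and z: "z \<in> unit_disc"
  shows "remove_sings (\<lambda>u. deriv (J_op n p \<delta> lam \<mu> l f) u / u ^ (p - 1)) z = J_quotient n p \<delta> lam \<mu> l f z"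
proof (rule remove_sings_eqI)
  let ?J = "J_op n p \<delta> lam \<mu> l f" and ?c = "J_coeff n p \<delta> lam \<mu> l f" and ?G = "J_quotient n p \<delta> lam \<mu> l f"
  have c: "disc_summable ?c"
    using assms by (intro disc_summable_J_coeff)
  have eq: "deriv ?J u / u ^ (p - 1) = ?G u" if u: "u \<in> unit_disc" "u \<noteq> 0" for u
  proof -
    have "u * deriv ?J u = euler (powser ?c) u"
      using euler_cong[OF J_op_eq_powser[OF assms(1-7)] u(1)] by (simp add: euler_def)
    also have "\<dots> = powser (\<lambda>k. of_nat k * ?c k) u"
      by (rule euler_powser[OF c u(1)])
    also have "\<dots> = u ^ p * ?G u"
      unfolding J_quotient_def
      by (rule powser_shift[OF disc_summable_of_nat_mult[OF c] u(1)])
         (simp add: J_coeff_def normalized_coeff_def)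
    also have "u ^ p = u * u ^ (p - 1)"
      using \<open>p \<ge> 1\<close> by (simp add: power_eq_if)
    finally show ?thesis
      using u(2) by (simp add: field_simps)
  qed
  have "?G holomorphic_on unit_disc"
    unfolding J_quotient_def using assms by (intro holomorphic_on_powser disc_summable_J_quotient)
  then have "?G \<midarrow>z\<rightarrow> ?G z"
    using z continuous_on_interior[of unit_disc ?G z] holomorphic_on_imp_continuous_on
    by (auto simp: isCont_def)
  moreover have "\<forall>\<^sub>F u in at z. ?G u = deriv ?J u / u ^ (p - 1)"
  proof -
    have "\<forall>\<^sub>F u in at z. u \<in> unit_disc"
      using z by (intro eventually_at_in_open') auto
    moreover have "\<forall>\<^sub>F u in at z. u \<noteq> 0"
      by (rule eventually_neq_at_within)
    ultimately show ?thesis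
      by eventually_elim (rule eq[symmetric])
  qed
  ultimately show "(\<lambda>u. deriv ?J u / u ^ (p - 1)) \<midarrow>z\<rightarrow> ?G z"
    by (rule Lim_transform_eventually)
qed

text \<open>The factor \<open>1 + a m + b m\<^sup>2\<close> relating the two coefficient sequences acts on power series as
  \<open>1 + a E + b E\<^sup>2\<close>, since \<open>E\<close> multiplies the coefficient of \<open>z\<^sup>m\<close> by \<open>m\<close>.\<close>

lemma J_quotient_add_one:
  assumes f: "f \<in> class_A n p" and "p \<ge> 1" "lam \<ge> \<mu>" "\<mu> \<ge> 0" "l \<ge> 0" "\<delta> \<ge> 0"
    and z: "z \<in> unit_disc"
  defines "G \<equiv> J_quotient n p \<delta> lam \<mu> l f"
  shows "J_quotient n p (\<delta> + 1) lam \<mu> l f z =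
    G z + of_real ((lam * \<mu> * real p + lam - \<mu>) / (real p + l)) * euler G z
        + of_real (lam * \<mu> / (real p + l)) * euler (euler G) z"
proof -
  define g where "g m = of_nat (m + p) * J_coeff n p \<delta> lam \<mu> l f (m + p)" for m
  define a b where "a = (lam * \<mu> * real p + lam - \<mu>) / (real p + l)" and "b = lam * \<mu> / (real p + l)"
  have g: "disc_summable g"
    unfolding g_def using assms by (intro disc_summable_J_quotient)
  have G: "G = powser g"
    by (simp add: G_def J_quotient_def g_def[abs_def])
  have "euler (euler G) z = euler (powser (\<lambda>m. of_nat m * g m)) z"
    unfolding G by (rule euler_cong[OF euler_powser[OF g] z])
  then have "(\<lambda>m. g m * z ^ m + of_real a * (of_nat m * g m * z ^ m)
          + of_real b * (of_nat m * (of_nat m * g m) * z ^ m))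
      sums (G z + of_real a * euler G z + of_real b * euler (euler G) z)"
    unfolding G
    using powser_sums[OF g z] euler_powser_sums[OF g z]
      euler_powser_sums[OF disc_summable_of_nat_mult[OF g] z]
    by (intro sums_add sums_mult) auto
  moreover have "g m * z ^ m + of_real a * (of_nat m * g m * z ^ m)
          + of_real b * (of_nat m * (of_nat m * g m) * z ^ m) =
      of_nat (m + p) * J_coeff n p (\<delta> + 1) lam \<mu> l f (m + p) * z ^ m" for m
    unfolding g_def J_coeff_def Phi_add_one[OF assms(2-5), folded a_def b_def]
    by (simp add: algebra_simps power2_eq_square)
  ultimately show ?thesis
    unfolding a_def[symmetric] b_def[symmetric] J_quotient_def powser_def
    by (simp add: sums_iff)
qed

lemma J_quotient_zero:
  assumes "p \<ge> 1" "l \<ge> 0"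
  shows "J_quotient n p \<delta> lam \<mu> l f 0 = of_nat p"
  using assms by (simp add: J_quotient_def powser_def J_coeff_def normalized_coeff_def Phi_at_p)

section \<open>The inclusion of the classes\<close>

lemma euler_affine:
  assumes "f holomorphic_on unit_disc" "z \<in> unit_disc"
  shows "euler (\<lambda>z. c * (f z - d)) z = c * euler f z"
proof -
  have "(f has_field_derivative deriv f z) (at z)"
    using holomorphic_derivI[OF assms(1)] assms(2) by simp
  then have "((\<lambda>z. c * (f z - d)) has_field_derivative c * deriv f z) (at z)"
    by (auto intro!: derivative_eq_intros)
  then show ?thesis
    by (simp add: euler_def DERIV_imp_deriv)
qed

theorem theorem2p2:
  fixes n p :: nat and lam \<mu> l \<sigma> \<delta> A\<^sub>1 A\<^sub>2 B\<^sub>1 B\<^sub>2 :: real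
  assumes "n \<ge> 1" and "p \<ge> 1"
    and "lam \<ge> \<mu>" and "\<mu> \<ge> 0" and "l \<ge> 0"
    and "0 \<le> \<sigma>" and "\<sigma> < real p"
    and "\<delta> \<ge> 0"
    and "-1 \<le> A\<^sub>2" and "A\<^sub>2 \<le> A\<^sub>1" and "A\<^sub>1 < B\<^sub>1" and "B\<^sub>1 \<le> B\<^sub>2" and "B\<^sub>2 \<le> 1"
  shows "class_P n p lam \<mu> l (\<delta> + 1) B\<^sub>1 A\<^sub>1 \<sigma> \<subseteq> class_P n p lam \<mu> l \<delta> B\<^sub>2 A\<^sub>2 \<sigma>"
proof
  fix f assume "f \<in> class_P n p lam \<mu> l (\<delta> + 1) B\<^sub>1 A\<^sub>1 \<sigma>"
  define c :: complex where "c = 1 / of_real (real p - \<sigma>)"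
  define F where "F \<epsilon> z = c * (J_quotient n p \<epsilon> lam \<mu> l f z - of_real \<sigma>)" for \<epsilon> z
  define a b where "a = (lam * \<mu> * real p + lam - \<mu>) / (real p + l)" and "b = lam * \<mu> / (real p + l)"
  let ?h = "\<lambda>C D z. (1 + of_real C * z) / (1 + of_real D * z) :: complex"
  from \<open>f \<in> class_P n p lam \<mu> l (\<delta> + 1) B\<^sub>1 A\<^sub>1 \<sigma>\<close> have f: "f \<in> class_A n p"
    by (simp add: class_P_def)
  have class_P_iff: "f \<in> class_P n p lam \<mu> l \<epsilon> C D \<sigma> \<longleftrightarrow> F \<epsilon> \<prec>\<^sub>s ?h C D" if "\<epsilon> \<ge> 0" for \<epsilon> C D
  proof -
    have "(\<lambda>z. 1 / of_real (real p - \<sigma>) *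
        (remove_sings (\<lambda>u. deriv (J_op n p \<epsilon> lam \<mu> l f) u / u ^ (p - 1)) z - of_real \<sigma>)) \<prec>\<^sub>s ?h C D
      \<longleftrightarrow> F \<epsilon> \<prec>\<^sub>s ?h C D"
      by (intro subordinate_cong) (simp only: F_def c_def remove_sings_deriv_J_op[OF f assms(1-5) that])
    then show ?thesis
      using f by (simp add: class_P_def)
  qed
  have G_holo: "J_quotient n p \<delta> lam \<mu> l f holomorphic_on unit_disc"
    unfolding J_quotient_def using f assms by (intro holomorphic_on_powser disc_summable_J_quotient)
  then have F_holo: "F \<delta> holomorphic_on unit_disc"
    unfolding F_def by (intro holomorphic_intros)
  have euler_F: "euler (F \<delta>) z = c * euler (J_quotient n p \<delta> lam \<mu> l f) z" if "z \<in> unit_disc" for z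
    unfolding F_def by (rule euler_affine[OF G_holo that])
  have euler2_F: "euler (euler (F \<delta>)) z = c * euler (euler (J_quotient n p \<delta> lam \<mu> l f)) z"
    if "z \<in> unit_disc" for z
    using euler_cong[OF euler_F that]
      euler_affine[OF holomorphic_on_euler[OF G_holo] that, of c 0] by simp
  have F_add_one: "F (\<delta> + 1) z = F \<delta> z + of_real a * euler (F \<delta>) z + of_real b * euler (euler (F \<delta>)) z"
    if "z \<in> unit_disc" for z
    using J_quotient_add_one[OF f assms(2-5,8) that]
    by (simp add: euler_F[OF that] euler2_F[OF that] F_def a_def b_def algebra_simps)
  have "F (\<delta> + 1) \<prec>\<^sub>s ?h B\<^sub>1 A\<^sub>1"
    using \<open>f \<in> class_P n p lam \<mu> l (\<delta> + 1) B\<^sub>1 A\<^sub>1 \<sigma>\<close> \<open>\<delta> \<ge> 0\<close> by (simp add: class_P_iff)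
  then have range_add_one: "F (\<delta> + 1) z \<in> janowski_domain B\<^sub>2 A\<^sub>2" if "z \<in> unit_disc" for z
    using that moebius_in_janowski_domain[OF _ assms(9-13)] by (auto simp: subordinate_def)
  have ab: "a \<ge> 0" "b \<ge> 0"
    using assms by (simp_all add: a_def b_def add_diff_eq[symmetric])
  have A\<^sub>2: "\<bar>A\<^sub>2\<bar> \<le> 1" "A\<^sub>2 < B\<^sub>2"
    using assms by auto
  have "F \<delta> \<prec>\<^sub>s ?h B\<^sub>2 A\<^sub>2"
  proof (rule subordinate_moebiusI[OF F_holo _ A\<^sub>2])
    show "F \<delta> 0 = 1"
    proof -
      have "complex_of_real (real p - \<sigma>) \<noteq> 0"
        using assms by (simp del: of_real_diff)
      then show ?thesis
        using assms by (simp add: F_def c_def J_quotient_zero)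
    qed
    show "F \<delta> z \<in> janowski_domain B\<^sub>2 A\<^sub>2" if "z \<in> unit_disc" for z
      using convex_range_euler[OF F_holo ab convex_janowski_domain[OF A\<^sub>2(1)] open_janowski_domain _ that]
        range_add_one F_add_one by simp
  qed
  then show "f \<in> class_P n p lam \<mu> l \<delta> B\<^sub>2 A\<^sub>2 \<sigma>"
    using \<open>\<delta> \<ge> 0\<close> by (simp add: class_P_iff)
qed

end
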